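(* Assume that $\nabla f:X\to X$ is $\alpha$-strongly monotone for some $\alpha>0$, i.e. $\langle\nabla f(x)-\nabla f(y),x-y\rangle_X\ge\alpha\|x-y\|_X^2$ for all $x,y\in X$, and that $A^*:Y\to X$ is bounded from below, i.e. there exists $\beta>0$ such that $\|A^*y\|_X^2\ge\beta\|y\|_Y^2$ for all $y\in Y$. Let $(x,\lambda):[0,+\infty)\to X\times Y$ be a solution of the Arrow--Hurwicz differential system (AH). Then, for $(\xi,\eta)\in S\times M$ (the unique saddle point of $L$), $$L(x(t),\eta)-L(\xi,\lambda(t))=o\Big(\frac1t\Big)\quad\text{as } t\to+\infty,$$ $$\|(x(t),\lambda(t))-(\xi,\eta)\|=o\Big(\frac1{\sqrt t}\Big)\quad\text{as } t\to+\infty .$$ Consequently, $(x(t),\lambda(t))$ converges strongly, as $t\to+\infty$, to the unique element in $S\times M$.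
   Context: $X$ and $Y$ are real Hilbert spaces with inner products $\langle\cdot,\cdot\rangle_X$, $\langle\cdot,\cdot\rangle_Y$ and norms $\|\cdot\|_X,\|\cdot\|_Y$; $X\times Y$ carries the product Hilbert structure, with norm $\|\cdot\|$. Standing assumptions: $f:X\to\mathbb R$ is convex and continuously differentiable; $\nabla f:X\to X$ is Lipschitz continuous on bounded sets; $A:X\to Y$ is linear and continuous with adjoint $A^*$; $b\in Y$. The Lagrangian is $L:X\times Y\to\mathbb R$, $L(x,\lambda)=f(x)+\langle\lambda,Ax-b\rangle_Y$. A saddle point of $L$ is a pair $(\bar x,\bar\lambda)\in X\times Y$ with $L(\bar x,\lambda)\le L(\bar x,\bar\lambda)\le L(x,\bar\lambda)$ for all $(x,\lambda)\in X\times Y$; the set of saddle points of $L$ is denoted by $S\times M\subset X\times Y$. Under the hypotheses of the claim, $S\times M$ consists of exactly one element. The system (AH) is $$\dot x+\nabla f(x)+A^*\lambda=0_X,\qquad \dot\lambda+b-Ax=0_Y,$$ with initial data $(x(0),\lambda(0))=(x_0,\lambda_0)\in X\times Y$; a solution is a function $(x,\lambda)\in\mathcal C^1([0,+\infty);X\times Y)$ satisfying the system on $[0,+\infty)$ with these initial data. *)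

theory Defs
  imports "HOL-Analysis.Analysis" "HOL-Library.Landau_Symbols"
begin

definition lagrangian ::
  "('a::real_inner \<Rightarrow> real) \<Rightarrow> ('a \<Rightarrow> 'b::real_inner) \<Rightarrow> 'b \<Rightarrow> 'a \<Rightarrow> 'b \<Rightarrow> real" where
  "lagrangian f A b x l = f x + l \<bullet> (A x - b)"

definition saddle_points :: "('a \<Rightarrow> 'b \<Rightarrow> real) \<Rightarrow> ('a \<times> 'b) set" where
  "saddle_points L = {(xbar, lbar). \<forall>x l. L xbar l \<le> L xbar lbar \<and> L xbar lbar \<le> L x lbar}"

definition lipschitz_on_bounded_sets :: "('a::metric_space \<Rightarrow> 'b::metric_space) \<Rightarrow> bool" where
  "lipschitz_on_bounded_sets g \<longleftrightarrow> (\<forall>B. bounded B \<longrightarrow> (\<exists>K. K-lipschitz_on B g))"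

definition strongly_monotone :: "real \<Rightarrow> ('a::real_inner \<Rightarrow> 'a) \<Rightarrow> bool" where
  "strongly_monotone \<alpha> g \<longleftrightarrow> (\<forall>x y. (g x - g y) \<bullet> (x - y) \<ge> \<alpha> * (norm (x - y))\<^sup>2)"

text \<open>
  The argument \<open>g\<close> stands for the gradient of the objective. Derivatives are taken within
  \<open>{0..}\<close>, hence are one-sided at \<open>0\<close>, where the library's \<open>C1_differentiable_on\<close> would
  demand a two-sided derivative.
\<close>

definition AH_solution ::
  "('a::real_inner \<Rightarrow> 'a) \<Rightarrow> ('a \<Rightarrow> 'b::real_inner) \<Rightarrow> 'b \<Rightarrow> 'a \<Rightarrow> 'b \<Rightarrow>
    (real \<Rightarrow> 'a) \<Rightarrow> (real \<Rightarrow> 'b) \<Rightarrow> bool" where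
  "AH_solution g A b x0 l0 x l \<longleftrightarrow>
    (\<exists>x' l'.
      continuous_on {0..} x' \<and> continuous_on {0..} l' \<and>
      (\<forall>t\<ge>0. (x has_vector_derivative x' t) (at t within {0..}) \<and>
              (l has_vector_derivative l' t) (at t within {0..}) \<and>
              x' t + g (x t) + adjoint A (l t) = 0 \<and>
              l' t + b - A (x t) = 0)) \<and>
    x 0 = x0 \<and> l 0 = l0"

end

theory Submission
  imports Defs "HOL-Real_Asymp.Real_Asymp"
begin

text \<open>
  A strongly convex function attains its minimum on a closed convex set. Applied to quadratic
  functionals this yields the adjoint of \<open>A\<close> and the solvability of \<open>A (A\<^sup>* y) = d\<close>; applied to
  \<open>f\<close> on \<open>{u. A u = b}\<close> it yields \<open>\<xi>\<close>, and correcting the gradient at \<open>\<xi>\<close> by an element of the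
  range of \<open>A\<^sup>*\<close> yields the multiplier \<open>\<eta>\<close>. With \<open>z = x - \<xi>\<close> and \<open>m = \<lambda> - \<eta>\<close>, the energy
  \<open>E = (\<parallel>z\<parallel>\<^sup>2 + \<parallel>m\<parallel>\<^sup>2) / 2\<close> is nonincreasing, so trajectories are bounded and the gradient is Lipschitz
  along them. Then \<open>V = E + \<epsilon> (z \<bullet> A\<^sup>* m)\<close> satisfies \<open>V' \<le> - c V\<close> for small \<open>\<epsilon> > 0\<close>, hence the
  distance to the saddle point decays exponentially, and so does the gap, which is
  \<open>O(\<parallel>z\<parallel>\<^sup>2)\<close> by convexity. This is stronger than the rates claimed.
\<close>

section \<open>Minimisation, adjoints and the normal equation in Hilbert spaces\<close>

text \<open>Midpoints stay in \<open>C\<close>, so their values cannot drop below the infimum;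
  \<open>mid\<close> then forces points of nearly minimal value to be close together. A minimising
  sequence is therefore Cauchy, and its limit lies in the closed set \<open>C\<close>.\<close>

lemma midpoint_convex_attains_Inf:
  fixes F :: "'a::{real_normed_vector, complete_space} \<Rightarrow> real"
  assumes C: "closed C" "C \<noteq> {}" "\<And>u v. u \<in> C \<Longrightarrow> v \<in> C \<Longrightarrow> (1/2) *\<^sub>R (u + v) \<in> C"
    and cont: "continuous_on UNIV F"
    and lower: "\<And>u. u \<in> C \<Longrightarrow> m \<le> F u"
    and c: "c > 0"
    and mid: "\<And>u v. u \<in> C \<Longrightarrow> v \<in> C \<Longrightarrow>
      F ((1/2) *\<^sub>R (u + v)) \<le> (F u + F v) / 2 - c * (norm (u - v))\<^sup>2"
  obtains z where "z \<in> C" "\<And>u. u \<in> C \<Longrightarrow> F z \<le> F u"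
proof -
  define I where "I = Inf (F ` C)"
  have bdd: "bdd_below (F ` C)"
    using lower by (auto simp: bdd_below_def)
  have I_le: "I \<le> F u" if "u \<in> C" for u
    unfolding I_def using bdd that by (intro cInf_lower) auto
  have "\<exists>u\<in>C. F u < I + inverse (real (Suc n))" for n
  proof -
    have "Inf (F ` C) < I + inverse (real (Suc n))"
      unfolding I_def by simp
    then show ?thesis
      using cInf_less_iff[OF _ bdd] C(2) by auto
  qed
  then obtain s where s: "\<And>n. s n \<in> C" "\<And>n. F (s n) < I + inverse (real (Suc n))"
    by metis
  have dist_bound: "c * (norm (s i - s j))\<^sup>2 < e"
    if "inverse (real (Suc i)) < e" "inverse (real (Suc j)) < e" for i j e
    using mid[OF s(1)[of i] s(1)[of j]] I_le[OF C(3)[OF s(1)[of i] s(1)[of j]]] s(2)[of i] s(2)[of j] that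
    by argo
  have "Cauchy s"
  proof (rule metric_CauchyI)
    fix e :: real assume e: "e > 0"
    then have "c * e\<^sup>2 > 0"
      using c by simp
    then obtain N where N: "inverse (real (Suc N)) < c * e\<^sup>2"
      using reals_Archimedean by blast
    have "dist (s i) (s j) < e" if "i \<ge> N" "j \<ge> N" for i j
    proof -
      have "inverse (real (Suc i)) < c * e\<^sup>2" "inverse (real (Suc j)) < c * e\<^sup>2"
        using N that by (auto intro!: le_less_trans[OF le_imp_inverse_le N] simp del: of_nat_Suc)
      then have "c * (norm (s i - s j))\<^sup>2 < c * e\<^sup>2"
        by (rule dist_bound)
      then have "(norm (s i - s j))\<^sup>2 < e\<^sup>2"
        using c by simp
      then show ?thesis
        using e by (simp add: dist_norm power_less_imp_less_base)
    qed
    then show "\<exists>M. \<forall>m\<ge>M. \<forall>n\<ge>M. dist (s m) (s n) < e"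
      by blast
  qed
  then obtain z where z: "s \<longlonglongrightarrow> z"
    using Cauchy_convergent unfolding convergent_def by blast
  have "z \<in> C"
    using C(1) s(1) z closed_sequentially by blast
  moreover have "F z \<le> I"
  proof (rule LIMSEQ_le)
    show "(\<lambda>n. F (s n)) \<longlonglongrightarrow> F z"
      using cont z by (metis UNIV_I continuous_on_eq_continuous_at isCont_tendsto_compose open_UNIV)
    show "(\<lambda>n. I + inverse (real (Suc n))) \<longlonglongrightarrow> I"
      using tendsto_add[OF tendsto_const LIMSEQ_inverse_real_of_nat] by simp
    show "\<exists>N. \<forall>n\<ge>N. F (s n) \<le> I + inverse (real (Suc n))"
      using s(2) less_imp_le by blast
  qed
  ultimately show ?thesis
    using that I_le order_trans by blast
qed

lemma linear_term_zero_if_quadratic_nonneg: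
  fixes p q :: real
  assumes "\<And>t. 0 \<le> t * p + t\<^sup>2 * q"
  shows "p = 0"
proof -
  \<comment> \<open>Any positive \<open>k > q\<close> would do: at \<open>t = - p / k\<close> the
    quadratic is negative unless \<open>p = 0\<close>.\<close>
  define k where "k = \<bar>q\<bar> + 1"
  have k: "k > 0" "q < k" unfolding k_def by auto
  have "0 \<le> (- p / k) * p + (- p / k)\<^sup>2 * q" by (rule assms)
  also have "\<dots> = - (p\<^sup>2 * (k - q) / k\<^sup>2)"
    using k by (simp add: field_simps power2_eq_square)
  finally have "p\<^sup>2 * (k - q) / k\<^sup>2 \<le> 0" by simp
  then have "p\<^sup>2 \<le> 0" using k by (simp add: divide_le_0_iff mult_le_0_iff)
  then show ?thesis by simp
qed

text \<open>Completing the square. With \<open>s\<close> the norm of a point, it bounds the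
  functionals minimised below from below, uniformly in the point.\<close>

lemma quadratic_lower_bound:
  fixes a r s :: real
  assumes "a > 0"
  shows "- (r\<^sup>2 / (4 * a)) \<le> a * s\<^sup>2 - r * s"
proof -
  have "0 \<le> (2 * a * s - r)\<^sup>2 / (4 * a)" using assms by simp
  also have "\<dots> = a * s\<^sup>2 - r * s + r\<^sup>2 / (4 * a)"
    using assms by (simp add: power2_eq_square field_simps)
  finally show ?thesis by simp
qed

text \<open>The solution is the minimiser of the energy \<open>B u u / 2 - l u\<close>; the equation
  says that all directional derivatives of the energy vanish there.\<close>

lemma symmetric_Lax_Milgram:
  fixes B :: "'a::{real_normed_vector, complete_space} \<Rightarrow> 'a \<Rightarrow> real" and l :: "'a \<Rightarrow> real"
  assumes B: "bounded_bilinear B" and sym: "\<And>u v. B u v = B v u"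
    and c: "c > 0" and coercive: "\<And>u. c * (norm u)\<^sup>2 \<le> B u u"
    and l: "bounded_linear l"
  obtains z where "\<And>v. B z v = l v"
proof -
  interpret B: bounded_bilinear B by fact
  interpret l: bounded_linear l by fact
  define F where "F u = B u u / 2 - l u" for u
  obtain K where K: "\<And>u. norm (l u) \<le> norm u * K"
    using l.bounded by blast
  \<comment> \<open>By the parallelogram identity the midpoint defect is exactly
    \<open>B (u - v) (u - v) / 8\<close>, whence the constant \<open>c / 8\<close>.\<close>
  have mid: "F ((1/2) *\<^sub>R (u + v)) \<le> (F u + F v) / 2 - c / 8 * (norm (u - v))\<^sup>2" for u v
  proof -
    have "F ((1/2) *\<^sub>R (u + v)) = (F u + F v) / 2 - B (u - v) (u - v) / 8"
      unfolding F_def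
      by (simp add: B.scaleR_left B.scaleR_right B.add_left B.add_right B.diff_left B.diff_right
          l.scaleR l.add sym[of v u] field_simps)
    then show ?thesis using coercive[of "u - v"] by simp
  qed
  have lower: "- (K\<^sup>2 / (4 * (c/2))) \<le> F u" for u
  proof -
    have "F u \<ge> c/2 * (norm u)\<^sup>2 - K * norm u"
      unfolding F_def using coercive[of u] K[of u] by (simp add: abs_le_iff mult.commute)
    then show ?thesis using quadratic_lower_bound[of "c/2" K "norm u"] c by linarith
  qed
  have cont: "continuous_on UNIV F"
    unfolding F_def by (intro continuous_intros B.continuous_on l.continuous_on) auto
  obtain z where z: "\<And>u. F z \<le> F u"
    by (rule midpoint_convex_attains_Inf[of UNIV F "- (K\<^sup>2 / (4 * (c/2)))" "c/8"])
      (use cont lower c mid in auto)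
  have "B z v = l v" for v
  proof -
    have "0 \<le> t * (B z v - l v) + t\<^sup>2 * (B v v / 2)" for t
    proof -
      have "F (z + t *\<^sub>R v) - F z = t * (B z v - l v) + t\<^sup>2 * (B v v / 2)"
        unfolding F_def
        by (simp add: B.scaleR_left B.scaleR_right B.add_left B.add_right l.scaleR l.add
            sym[of v z] power2_eq_square field_simps)
      then show ?thesis using z[of "z + t *\<^sub>R v"] by linarith
    qed
    then show ?thesis using linear_term_zero_if_quadratic_nonneg by fastforce
  qed
  then show ?thesis using that by blast
qed

text \<open>\<open>adjoint\<close> is defined by choice, so its characteristic identity requires an
  existence proof. Lax-Milgram for the inner product itself is the Riesz representation theorem,
  applied here to the functional sending \<open>v\<close> to the inner product of \<open>A v\<close>
  and \<open>y\<close>.\<close>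

lemma adjoint_inner_Hilbert:
  fixes A :: "'a::{real_inner, complete_space} \<Rightarrow> 'b::real_inner"
  assumes "bounded_linear A"
  shows "A u \<bullet> y = u \<bullet> adjoint A y"
proof -
  have "\<exists>z. \<forall>v. A v \<bullet> y = v \<bullet> z" for y
  proof -
    obtain z where "\<And>v. z \<bullet> v = A v \<bullet> y"
      by (rule symmetric_Lax_Milgram[of "(\<bullet>)" 1 "\<lambda>v. A v \<bullet> y"])
        (auto simp: bounded_bilinear_inner inner_commute[of "_ :: 'a"] power2_norm_eq_inner
          intro!: bounded_linear_inner_left_comp assms)
    then show ?thesis by (metis inner_commute)
  qed
  then have "\<exists>A'. \<forall>v y. A v \<bullet> y = v \<bullet> A' y"
    by metis
  then have "\<forall>v y. A v \<bullet> y = v \<bullet> adjoint A y"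
    unfolding adjoint_def by (rule someI_ex)
  then show ?thesis by blast
qed

lemma norm_adjoint_le:
  fixes A :: "'a::{real_inner, complete_space} \<Rightarrow> 'b::real_inner"
  assumes A: "bounded_linear A" and K: "\<And>u. norm (A u) \<le> K * norm u" and "K \<ge> 0"
  shows "norm (adjoint A y) \<le> K * norm y"
proof (cases "norm (adjoint A y) = 0")
  case True
  then show ?thesis using \<open>K \<ge> 0\<close> by simp
next
  case False
  have "norm (adjoint A y) * norm (adjoint A y) = A (adjoint A y) \<bullet> y"
    by (simp add: adjoint_inner_Hilbert[OF A] flip: power2_norm_eq_inner power2_eq_square)
  also have "\<dots> \<le> norm (A (adjoint A y)) * norm y"
    by (rule norm_cauchy_schwarz)
  also have "\<dots> \<le> norm (adjoint A y) * (K * norm y)"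
    using mult_right_mono[OF K[of "adjoint A y"] norm_ge_zero[of y]] by (simp add: mult_ac)
  finally show ?thesis
    using False by (simp add: mult_le_cancel_left)
qed

lemma bounded_linear_adjoint:
  fixes A :: "'a::{real_inner, complete_space} \<Rightarrow> 'b::real_inner"
  assumes A: "bounded_linear A"
  shows "bounded_linear (adjoint A)"
proof -
  obtain K where K: "K > 0" "\<And>u. norm (A u) \<le> norm u * K"
    using bounded_linear.pos_bounded[OF A] by blast
  show ?thesis
  proof (rule bounded_linear_intro[of _ K])
    show "adjoint A (y + z) = adjoint A y + adjoint A z" for y z
      by (rule vector_eq_ldot[THEN iffD1])
        (simp add: inner_add_right flip: adjoint_inner_Hilbert[OF A])
    show "adjoint A (r *\<^sub>R y) = r *\<^sub>R adjoint A y" for r y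
      by (rule vector_eq_ldot[THEN iffD1])
        (simp flip: adjoint_inner_Hilbert[OF A])
    show "norm (adjoint A y) \<le> norm y * K" for y
      using norm_adjoint_le[OF A, of K y] K less_imp_le[OF K(1)] by (simp add: mult.commute)
  qed
qed

text \<open>The lower bound on \<open>adjoint A\<close> is precisely coercivity of the form pairing
  \<open>adjoint A u\<close> with \<open>adjoint A v\<close>, and the normal equation is its
  Lax-Milgram equation. In particular \<open>A\<close> is surjective.\<close>

lemma normal_equation_solvable:
  fixes A :: "'a::{real_inner, complete_space} \<Rightarrow> 'b::{real_inner, complete_space}"
  assumes A: "bounded_linear A" and \<beta>: "\<beta> > 0"
    and below: "\<And>y. (norm (adjoint A y))\<^sup>2 \<ge> \<beta> * (norm y)\<^sup>2"
  obtains y where "A (adjoint A y) = d"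
proof -
  obtain y where y: "\<And>v. adjoint A y \<bullet> adjoint A v = d \<bullet> v"
  proof (rule symmetric_Lax_Milgram[of "\<lambda>u v. adjoint A u \<bullet> adjoint A v" \<beta> "\<lambda>v. d \<bullet> v"])
    show "bounded_bilinear (\<lambda>u v. adjoint A u \<bullet> adjoint A v)"
      using bounded_bilinear.comp[OF bounded_bilinear_inner bounded_linear_adjoint[OF A]
          bounded_linear_adjoint[OF A]] .
  qed (use below \<beta> in \<open>auto simp: inner_commute bounded_linear_inner_right simp flip: power2_norm_eq_inner\<close>)
  have "A (adjoint A y) = d"
    by (rule vector_eq_rdot[THEN iffD1])
      (simp add: adjoint_inner_Hilbert[OF A] y)
  then show ?thesis by (rule that)
qed

section \<open>Strong monotonicity of the gradient\<close>

lemma GDERIV_along_line: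
  assumes "\<And>z. GDERIV f z :> g z"
  shows "((\<lambda>t. f (u + t *\<^sub>R d)) has_real_derivative g (u + t *\<^sub>R d) \<bullet> d) (at t)"
proof -
  have "((\<lambda>t. f (u + t *\<^sub>R d)) has_derivative (\<lambda>h. (h *\<^sub>R d) \<bullet> g (u + t *\<^sub>R d))) (at t)"
    by (rule has_derivative_compose[of "\<lambda>t. u + t *\<^sub>R d" _ _ _ f])
      (use assms in \<open>auto intro!: derivative_eq_intros simp: gderiv_def\<close>)
  moreover have "(\<lambda>h. (h *\<^sub>R d) \<bullet> g (u + t *\<^sub>R d)) = (*) (g (u + t *\<^sub>R d) \<bullet> d)"
    by (simp add: fun_eq_iff inner_commute)
  ultimately show ?thesis
    by (simp add: has_field_derivative_def)
qed

lemma strongly_monotone_gradient_ineq: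
  assumes f: "\<And>z. GDERIV f z :> g z" and g: "strongly_monotone \<alpha> g"
  shows "f u + g u \<bullet> (v - u) + \<alpha> / 2 * (norm (v - u))\<^sup>2 \<le> f v"
proof -
  define d where "d = v - u"
  \<comment> \<open>The asserted inequality is \<open>h 0 \<le> h 1\<close>. Strong monotonicity
    between \<open>u + t *\<^sub>R d\<close> and \<open>u\<close> gives \<open>t\<close> times the
    derivative of \<open>h\<close> a sign; at \<open>t = 0\<close> the derivative vanishes.\<close>
  define h where "h t = f (u + t *\<^sub>R d) - t * (g u \<bullet> d) - \<alpha> / 2 * t\<^sup>2 * (norm d)\<^sup>2" for t
  have "h 0 \<le> h 1"
  proof (rule DERIV_nonneg_imp_nondecreasing[of 0 1 h])
    fix t :: real assume t: "0 \<le> t" "t \<le> 1"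
    let ?D = "(g (u + t *\<^sub>R d) - g u) \<bullet> d - \<alpha> * t * (norm d)\<^sup>2"
    have "(h has_real_derivative ?D) (at t)"
      unfolding h_def
      by (auto intro!: derivative_eq_intros GDERIV_along_line[OF f] simp: inner_diff_left)
    moreover have "0 \<le> ?D"
    proof (cases "t = 0")
      case False
      then have "t > 0" using t by simp
      have "\<alpha> * (norm (t *\<^sub>R d))\<^sup>2 \<le> (g (u + t *\<^sub>R d) - g u) \<bullet> (t *\<^sub>R d)"
        using g[unfolded strongly_monotone_def, rule_format, where x = "u + t *\<^sub>R d" and y = u] by simp
      then have "t * (\<alpha> * t * (norm d)\<^sup>2) \<le> t * ((g (u + t *\<^sub>R d) - g u) \<bullet> d)"
        by (simp add: power_mult_distrib power2_eq_square mult_ac)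
      then show ?thesis using \<open>t > 0\<close> by simp
    qed simp
    ultimately show "\<exists>D. (h has_real_derivative D) (at t) \<and> 0 \<le> D" by blast
  qed simp
  then show ?thesis by (simp add: h_def d_def)
qed

section \<open>The saddle point\<close>

text \<open>Minimality is asked along a single line only, so that the lemma serves both the
  constrained problem, with directions in the kernel of \<open>A\<close>, and the unconstrained
  one.\<close>

lemma gradient_eq_zero_at_minimiser:
  assumes f: "\<And>z. GDERIV f z :> g z" and min: "\<And>t. f u \<le> f (u + t *\<^sub>R d)"
  shows "g u \<bullet> d = 0"
proof -
  have "((\<lambda>t. f (u + t *\<^sub>R d)) has_real_derivative g (u + 0 *\<^sub>R d) \<bullet> d) (at 0)"
    by (rule GDERIV_along_line[OF f])
  from DERIV_local_min[OF this, of 1] min show ?thesis by simp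
qed

lemma exists_KKT_point:
  fixes f :: "'a::{real_inner, complete_space} \<Rightarrow> real"
    and A :: "'a \<Rightarrow> 'b::{real_inner, complete_space}"
  assumes f: "\<And>z. GDERIV f z :> g z" and \<alpha>: "\<alpha> > 0" and g: "strongly_monotone \<alpha> g"
    and A: "bounded_linear A" and \<beta>: "\<beta> > 0"
    and below: "\<And>y. (norm (adjoint A y))\<^sup>2 \<ge> \<beta> * (norm y)\<^sup>2"
  obtains \<xi> \<eta> where "A \<xi> = b" "g \<xi> + adjoint A \<eta> = 0"
proof -
  interpret A: bounded_linear A by fact
  note normal = normal_equation_solvable[OF A \<beta> below]
  note ineq = strongly_monotone_gradient_ineq[OF f g]
  obtain \<xi> where \<xi>: "\<xi> \<in> {u. A u = b}" "\<And>u. u \<in> {u. A u = b} \<Longrightarrow> f \<xi> \<le> f u"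
  proof (rule midpoint_convex_attains_Inf[of "{u. A u = b}" f "f 0 - (norm (g 0))\<^sup>2 / (4 * (\<alpha>/2))" "\<alpha>/8"])
    show "closed {u. A u = b}"
      by (intro closed_Collect_eq A.continuous_on continuous_intros)
    show "{u. A u = b} \<noteq> {}"
      using normal[of b] by auto
    show "(1/2) *\<^sub>R (u + v) \<in> {u. A u = b}" if "u \<in> {u. A u = b}" "v \<in> {u. A u = b}" for u v
      using that by (simp add: A.scaleR A.add flip: scaleR_2)
    show "continuous_on UNIV f"
      by (metis f continuous_at_imp_continuous_on gderiv_def has_derivative_continuous)
    show "f 0 - (norm (g 0))\<^sup>2 / (4 * (\<alpha>/2)) \<le> f u" for u
      using ineq[of 0 u] quadratic_lower_bound[of "\<alpha>/2" "norm (g 0)" "norm u"] \<alpha>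
        Cauchy_Schwarz_ineq2[of "g 0" u] by simp
    show "f ((1/2) *\<^sub>R (u + v)) \<le> (f u + f v) / 2 - \<alpha> / 8 * (norm (u - v))\<^sup>2" for u v
    proof -
      \<comment> \<open>The gradient inequality is taken from the midpoint to both ends: the linear
        terms cancel in the average, and half the distance squared turns \<alpha>/2 into
        \<alpha>/8.\<close>
      define m where "m = (1/2) *\<^sub>R (u + v)"
      have "u - m = (1/2) *\<^sub>R (u - v)" "v - m = - ((1/2) *\<^sub>R (u - v))"
        unfolding m_def by (simp_all add: algebra_simps flip: scaleR_2)
      then have "f m + g m \<bullet> (u - v) / 2 + \<alpha> * (norm (u - v))\<^sup>2 / 8 \<le> f u"
        "f m - g m \<bullet> (u - v) / 2 + \<alpha> * (norm (u - v))\<^sup>2 / 8 \<le> f v"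
        using ineq[of m u] ineq[of m v] by (simp_all add: power_divide)
      then show ?thesis unfolding m_def by argo
    qed
  qed (use \<alpha> in auto)
  \<comment> \<open>This choice puts the residual \<open>w\<close> in the kernel of
    \<open>A\<close>. Moving along \<open>w\<close> keeps the constraint, so \<open>w\<close> is
    orthogonal to \<open>g \<xi>\<close>; it is also orthogonal to the range of
    \<open>adjoint A\<close>. Hence \<open>w\<close> is orthogonal to itself, and \<open>- y\<close>
    is the multiplier.\<close>
  obtain y where y: "A (adjoint A y) = A (g \<xi>)"
    using normal .
  have lin: "adjoint A (- y) = - adjoint A y"
    using linear_neg bounded_linear.linear bounded_linear_adjoint[OF A] by blast
  define w where "w = g \<xi> + adjoint A (- y)"
  have "A w = 0"
    unfolding w_def lin by (simp add: A.diff y)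
  then have "g \<xi> \<bullet> w = 0"
    using \<xi> by (intro gradient_eq_zero_at_minimiser[OF f]) (auto simp: A.add A.scaleR)
  moreover have "w \<bullet> adjoint A (- y) = 0"
    using \<open>A w = 0\<close> by (simp flip: adjoint_inner_Hilbert[OF A])
  ultimately have "w \<bullet> w = 0"
    by (subst (2) w_def) (simp add: inner_add_right inner_commute)
  then show ?thesis
    using that[of \<xi> "- y"] \<xi>(1) by (simp add: w_def)
qed

text \<open>The Lagrangian is affine in the multiplier, so a maximum there forces feasibility; a
  minimum in the primal variable is a zero of the partial gradient. Conversely, the gradient
  inequality makes such a zero a global minimum.\<close>

lemma saddle_point_iff_KKT:
  fixes A :: "'a::{real_inner, complete_space} \<Rightarrow> 'b::real_inner"
  assumes f: "\<And>z. GDERIV f z :> g z" and \<alpha>: "\<alpha> \<ge> 0" and g: "strongly_monotone \<alpha> g"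
    and A: "bounded_linear A"
  shows "(u, y) \<in> saddle_points (lagrangian f A b) \<longleftrightarrow> A u = b \<and> g u + adjoint A y = 0"
proof -
  interpret A: bounded_linear A by fact
  show ?thesis
  proof
    assume "(u, y) \<in> saddle_points (lagrangian f A b)"
    then have max: "\<And>l. l \<bullet> (A u - b) \<le> y \<bullet> (A u - b)"
      and min: "\<And>v. f u + y \<bullet> (A u - b) \<le> f v + y \<bullet> (A v - b)"
      by (auto simp: saddle_points_def lagrangian_def)
    have "(A u - b) \<bullet> (A u - b) \<le> 0"
      using max[of "y + (A u - b)"] by (simp add: inner_add_left)
    then have "A u = b" by (metis antisym inner_eq_zero_iff inner_ge_zero right_minus_eq)
    moreover have "g u + adjoint A y = 0"
    proof -
      have "GDERIV (\<lambda>v. f v + y \<bullet> (A v - b)) z :> (g z + adjoint A y)" for z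
        using f[of z] unfolding gderiv_def
        by (auto intro!: derivative_eq_intros A.has_derivative
            simp: inner_add_right inner_commute[of y] adjoint_inner_Hilbert[OF A])
      from gradient_eq_zero_at_minimiser[OF this, of u "g u + adjoint A y"] min
      show ?thesis by simp
    qed
    ultimately show "A u = b \<and> g u + adjoint A y = 0" ..
  next
    assume u: "A u = b \<and> g u + adjoint A y = 0"
    have "f u \<le> f v + y \<bullet> (A v - b)" for v
    proof -
      have "y \<bullet> (A v - b) = (v - u) \<bullet> adjoint A y"
        using u by (simp add: inner_commute[of y] A.diff flip: adjoint_inner_Hilbert[OF A])
      moreover have "adjoint A y = - g u"
        using u by (simp add: eq_neg_iff_add_eq_0 add.commute)
      moreover have "0 \<le> \<alpha> / 2 * (norm (v - u))\<^sup>2"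
        using \<alpha> by simp
      ultimately show ?thesis
        using strongly_monotone_gradient_ineq[OF f g, of u v] by (simp add: inner_commute)
    qed
    then show "(u, y) \<in> saddle_points (lagrangian f A b)"
      using u by (auto simp: saddle_points_def lagrangian_def)
  qed
qed

text \<open>The gradient difference lies in the range of \<open>adjoint A\<close>, while
  \<open>u - v\<close> lies in the kernel of \<open>A\<close>; their inner product vanishes and
  strong monotonicity gives \<open>u = v\<close>. Then \<open>adjoint A (y - z) = 0\<close>, and the
  lower bound gives \<open>y = z\<close>.\<close>

lemma KKT_point_unique:
  fixes A :: "'a::{real_inner, complete_space} \<Rightarrow> 'b::real_inner"
  assumes \<alpha>: "\<alpha> > 0" and g: "strongly_monotone \<alpha> g"
    and A: "bounded_linear A" and \<beta>: "\<beta> > 0"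
    and below: "\<And>y. (norm (adjoint A y))\<^sup>2 \<ge> \<beta> * (norm y)\<^sup>2"
    and u: "A u = b" "g u + adjoint A y = 0"
    and v: "A v = b" "g v + adjoint A z = 0"
  shows "u = v \<and> y = z"
proof -
  interpret A: bounded_linear A by fact
  interpret A': bounded_linear "adjoint A" by (rule bounded_linear_adjoint[OF A])
  have g_diff: "g u - g v = - adjoint A (y - z)"
    using u(2) v(2) by (simp add: A'.diff eq_neg_iff_add_eq_0[symmetric] add_eq_0_iff2)
  have "(g u - g v) \<bullet> (u - v) = - (A (u - v) \<bullet> (y - z))"
    unfolding g_diff adjoint_inner_Hilbert[OF A] by (simp add: inner_commute)
  also have "\<dots> = 0"
    using u v by (simp add: A.diff)
  finally have "\<alpha> * (norm (u - v))\<^sup>2 \<le> 0"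
    using g unfolding strongly_monotone_def by metis
  then have uv: "u = v"
    using \<alpha> by (simp add: mult_le_0_iff)
  then have "\<beta> * (norm (y - z))\<^sup>2 \<le> 0"
    using below[of "y - z"] g_diff by simp
  then show ?thesis
    using \<beta> uv by (simp add: mult_le_0_iff)
qed

section \<open>Exponential decay along trajectories\<close>

text \<open>Gronwall's argument with the integrating factor \<open>exp (c * t)\<close>. The sign of
  \<open>c\<close> is free, and \<open>c = 0\<close> yields plain monotonicity.\<close>

lemma exp_decay_of_differential_ineq:
  fixes V :: "real \<Rightarrow> real"
  assumes V: "\<And>t. t \<ge> 0 \<Longrightarrow> (V has_vector_derivative V' t) (at t within {0..})"
    and ineq: "\<And>t. t \<ge> 0 \<Longrightarrow> V' t \<le> - c * V t"
    and t: "t \<ge> 0"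
  shows "V t \<le> V 0 * exp (- c * t)"
proof -
  have "V t * exp (c * t) \<le> V 0 * exp (c * 0)"
  \<comment> \<open>The derivative at 0 is one-sided, so derivatives are used only in the open
    interval, with continuity at its ends.\<close>
  proof (rule DERIV_nonpos_imp_decreasing_open[OF t])
    fix s assume s: "0 < s" "s < t"
    have "(V has_real_derivative V' s) (at s)"
      using V[of s] s at_within_interior[of s "{0..}"]
      by (simp add: has_real_derivative_iff_has_vector_derivative)
    then have "((\<lambda>t. V t * exp (c * t)) has_real_derivative (V' s + c * V s) * exp (c * s)) (at s)"
      by (auto intro!: derivative_eq_intros simp: algebra_simps)
    moreover have "(V' s + c * V s) * exp (c * s) \<le> 0"
      using ineq[of s] s by (simp add: mult_le_0_iff)
    ultimately show "\<exists>D. ((\<lambda>t. V t * exp (c * t)) has_real_derivative D) (at s) \<and> D \<le> 0"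
      by blast
  next
    have "continuous_on {0..} V"
      unfolding continuous_on_eq_continuous_within
      using has_vector_derivative_continuous[OF V] by simp
    then have "continuous_on {0..t} V"
      by (rule continuous_on_subset) auto
    then show "continuous_on {0..t} (\<lambda>t. V t * exp (c * t))"
      by (intro continuous_intros)
  qed
  then have "V t * exp (c * t) * exp (- c * t) \<le> V 0 * exp (- c * t)"
    by simp
  then show ?thesis
    by (simp add: mult.assoc flip: exp_add)
qed

text \<open>
  The energy only dissipates through \<open>z\<close>; the cross term \<open>z \<bullet> A\<^sup>* m\<close> transfers the dissipation
  to \<open>m\<close>, because its derivative contains \<open>- \<parallel>A\<^sup>* m\<parallel>\<^sup>2\<close>.
\<close>

lemma AH_exp_decay:
  fixes A :: "'a::{real_inner, complete_space} \<Rightarrow> 'b::real_inner"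
  assumes lip: "lipschitz_on_bounded_sets g" and \<alpha>: "\<alpha> > 0" and g: "strongly_monotone \<alpha> g"
    and A: "bounded_linear A" and \<beta>: "\<beta> > 0"
    and below: "\<And>y. (norm (adjoint A y))\<^sup>2 \<ge> \<beta> * (norm y)\<^sup>2"
    and sol: "AH_solution g A b x0 lam0 x lam"
    and KKT: "A \<xi> = b" "g \<xi> + adjoint A \<eta> = 0"
  obtains c K C where "c > 0" "K \<ge> 0"
    "\<And>t. t \<ge> 0 \<Longrightarrow> (norm (x t - \<xi>))\<^sup>2 + (norm (lam t - \<eta>))\<^sup>2 \<le> C * exp (- c * t)"
    "\<And>t. t \<ge> 0 \<Longrightarrow> norm (g (x t) - g \<xi>) \<le> K * norm (x t - \<xi>)"
proof -
  interpret A: bounded_linear A by fact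
  interpret A': bounded_linear "adjoint A" by (rule bounded_linear_adjoint[OF A])
  define z where "z t = x t - \<xi>" for t
  define m where "m t = lam t - \<eta>" for t
  define p where "p t = g (x t) - g \<xi>" for t
  define q where "q t = adjoint A (m t)" for t
  obtain x' l' where x': "\<And>t. t \<ge> 0 \<Longrightarrow> (x has_vector_derivative x' t) (at t within {0..})"
      "\<And>t. t \<ge> 0 \<Longrightarrow> x' t + g (x t) + adjoint A (lam t) = 0"
    and l': "\<And>t. t \<ge> 0 \<Longrightarrow> (lam has_vector_derivative l' t) (at t within {0..})"
      "\<And>t. t \<ge> 0 \<Longrightarrow> l' t + b - A (x t) = 0"
    using sol unfolding AH_solution_def by blast
  have dz: "(z has_vector_derivative - (p t + q t)) (at t within {0..})" if "t \<ge> 0" for t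
  proof -
    have "x' t = - (g (x t) + adjoint A (lam t))"
      using x'(2)[OF that] unfolding eq_neg_iff_add_eq_0 by (simp add: add.assoc)
    moreover have "adjoint A \<eta> = - g \<xi>"
      using KKT(2) by (simp add: eq_neg_iff_add_eq_0 add.commute)
    ultimately have "x' t = - (p t + q t)"
      by (simp add: p_def q_def m_def A'.diff)
    then show ?thesis
      unfolding z_def using x'(1)[OF that] by (auto intro!: derivative_eq_intros)
  qed
  have dm: "(m has_vector_derivative A (z t)) (at t within {0..})" if "t \<ge> 0" for t
  proof -
    have "l' t = A (z t)"
      using l'(2)[OF that] KKT(1) by (simp add: z_def A.diff algebra_simps)
    then show ?thesis
      unfolding m_def using l'(1)[OF that] by (auto intro!: derivative_eq_intros)
  qed
  have dq: "(q has_vector_derivative adjoint A (A (z t))) (at t within {0..})" if "t \<ge> 0" for t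
    unfolding q_def by (rule A'.has_vector_derivative[OF dm[OF that]])
  note d_inner = bounded_bilinear.has_vector_derivative[OF bounded_bilinear_inner]
  have mono: "\<alpha> * (norm (z t))\<^sup>2 \<le> p t \<bullet> z t" for t
    using g by (simp add: strongly_monotone_def p_def z_def)

  define E where "E t = (z t \<bullet> z t + m t \<bullet> m t) / 2" for t
  have E_norm: "E t = ((norm (z t))\<^sup>2 + (norm (m t))\<^sup>2) / 2" for t
    by (simp add: E_def power2_norm_eq_inner)
  have dE: "(E has_vector_derivative - (p t \<bullet> z t)) (at t within {0..})" if "t \<ge> 0" for t
  proof -
    \<comment> \<open>The coupling is skew: its two contributions to the derivative of the energy
      cancel by adjointness.\<close>
    have "z t \<bullet> q t = m t \<bullet> A (z t)"
      by (simp add: q_def inner_commute[of "m t"] adjoint_inner_Hilbert[OF A])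
    then show ?thesis
      unfolding E_def
      by (auto intro!: derivative_eq_intros d_inner dz dm that
          simp: inner_add_right inner_diff_right inner_commute field_simps)
  qed
  have E_le: "E t \<le> E 0" if "t \<ge> 0" for t
    using exp_decay_of_differential_ineq[OF dE, of 0 t] that mono \<alpha>
    by (simp add: order_trans[rotated, OF mono])

  \<comment> \<open>Energy decrease confines \<open>x\<close> to one ball around \<xi>, so a single
    Lipschitz constant serves for all times.\<close>
  have in_ball: "x t \<in> cball \<xi> (sqrt (2 * E 0))" if "t \<ge> 0" for t
  proof -
    have "(norm (z t))\<^sup>2 \<le> 2 * E 0"
      using E_le[OF that] zero_le_power2[of "norm (m t)"] unfolding E_norm by argo
    then have "norm (z t) \<le> sqrt (2 * E 0)"
      by (rule real_le_rsqrt)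
    then show ?thesis
      by (simp add: dist_norm z_def norm_minus_commute)
  qed
  obtain K where K: "K-lipschitz_on (cball \<xi> (sqrt (2 * E 0))) g"
    using lip unfolding lipschitz_on_bounded_sets_def using bounded_cball by blast
  have "K \<ge> 0" using K by (rule lipschitz_on_nonneg)
  have p_le: "norm (p t) \<le> K * norm (z t)" if "t \<ge> 0" for t
    using lipschitz_onD[OF K in_ball[OF that], of \<xi>] E_norm[of 0]
    by (simp add: p_def z_def dist_norm)

  obtain N where N: "N > 0" "\<And>u. norm (A u) \<le> norm u * N"
    using A.pos_bounded by blast
  have q_le: "norm (q t) \<le> N * norm (m t)" for t
    unfolding q_def using N by (intro norm_adjoint_le[OF A]) (simp_all add: mult.commute)
  \<comment> \<open>\<open>P\<close> collects the cost in \<open>z\<close> of differentiating the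
    cross term: \<open>N\<^sup>2\<close> from \<open>A (z t)\<close>, and
    \<open>K\<^sup>2 / 2\<close> from Young's inequality for \<open>p\<close> and \<open>q\<close>.
    The bounds on \<epsilon> keep the cross term below \<open>E t / 2\<close> and let this cost use
    at most half of \<alpha>.\<close>
  define P where "P = K\<^sup>2 / 2 + N\<^sup>2"
  have "P > 0" using N by (simp add: P_def add_nonneg_pos)
  define \<epsilon> where "\<epsilon> = min (1 / (2 * N)) (\<alpha> / (2 * P))"
  have \<epsilon>: "\<epsilon> > 0" "\<epsilon> * N \<le> 1 / 2" "\<epsilon> * P \<le> \<alpha> / 2"
  proof -
    show "\<epsilon> > 0" using N \<open>P > 0\<close> \<alpha> by (simp add: \<epsilon>_def)
    have "\<epsilon> \<le> 1 / (2 * N)" "\<epsilon> \<le> \<alpha> / (2 * P)" by (simp_all add: \<epsilon>_def)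
    then show "\<epsilon> * N \<le> 1 / 2" "\<epsilon> * P \<le> \<alpha> / 2"
      using N \<open>P > 0\<close> by (simp_all add: field_simps)
  qed
  define V where "V t = E t + \<epsilon> * (z t \<bullet> q t)" for t
  define V' where "V' t = - (p t \<bullet> z t) + \<epsilon> * ((norm (A (z t)))\<^sup>2 - p t \<bullet> q t - (norm (q t))\<^sup>2)" for t
  have dV: "(V has_vector_derivative V' t) (at t within {0..})" if "t \<ge> 0" for t
  proof -
    have "z t \<bullet> adjoint A (A (z t)) = (norm (A (z t)))\<^sup>2"
      by (simp add: power2_norm_eq_inner flip: adjoint_inner_Hilbert[OF A])
    then have "((\<lambda>t. z t \<bullet> q t) has_vector_derivative
        (norm (A (z t)))\<^sup>2 - p t \<bullet> q t - (norm (q t))\<^sup>2) (at t within {0..})"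
      using d_inner[OF dz[OF that] dq[OF that]]
      by (simp add: inner_add_left power2_norm_eq_inner algebra_simps)
    then show ?thesis
      unfolding V_def V'_def
      using dE[OF that] by (intro has_vector_derivative_add has_vector_derivative_mult_right)
  qed
  have cross: "\<bar>\<epsilon> * (z t \<bullet> q t)\<bar> \<le> E t / 2" for t
  proof -
    have "\<bar>z t \<bullet> q t\<bar> \<le> norm (z t) * (N * norm (m t))"
      using Cauchy_Schwarz_ineq2[of "z t" "q t"] q_le[of t]
      by (meson mult_left_mono norm_ge_zero order_trans)
    then have "\<bar>\<epsilon> * (z t \<bullet> q t)\<bar> \<le> \<epsilon> * (norm (z t) * (N * norm (m t)))"
      using \<epsilon>(1) by (simp add: abs_mult)
    also have "\<dots> = (\<epsilon> * N) * (norm (z t) * norm (m t))"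
      by simp
    also have "\<dots> \<le> 1 / 2 * (norm (z t) * norm (m t))"
      using \<epsilon>(2) by (intro mult_right_mono) auto
    also have "\<dots> \<le> E t / 2"
      using sum_squares_bound[of "norm (z t)" "norm (m t)"] unfolding E_norm by simp
    finally show ?thesis .
  qed
  \<comment> \<open>The dissipation retains at least \<alpha>/2 in \<open>z\<close> and
    \<open>\<epsilon> * \<beta> / 2\<close> in \<open>m\<close>, hence dominates
    \<open>2 * c * E t\<close>; since \<open>V t \<le> 2 * E t\<close>, this dominates
    \<open>c * V t\<close>.\<close>
  define c where "c = min (\<alpha> / 2) (\<epsilon> * \<beta> / 2)"
  have c: "c > 0" "c \<le> \<alpha> / 2" "c \<le> \<epsilon> * \<beta> / 2"
    using \<alpha> \<beta> \<epsilon>(1) by (auto simp: c_def)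
  have V'_le: "V' t \<le> - c * V t" if "t \<ge> 0" for t
  proof -
    have "(norm (A (z t)))\<^sup>2 \<le> N\<^sup>2 * (norm (z t))\<^sup>2"
      using power_mono[OF N(2)[of "z t"], of 2] by (simp add: power_mult_distrib mult.commute)
    \<comment> \<open>Young's inequality spends only half of the squared norm of \<open>q\<close>;
      the other half controls \<open>m\<close> through \<beta>.\<close>
    moreover have "- (p t \<bullet> q t) \<le> K\<^sup>2 / 2 * (norm (z t))\<^sup>2 + (norm (q t))\<^sup>2 / 2"
    proof -
      have "- (p t \<bullet> q t) \<le> norm (p t) * norm (q t)"
        using Cauchy_Schwarz_ineq2[of "p t" "q t"] by linarith
      also have "\<dots> \<le> (norm (p t))\<^sup>2 / 2 + (norm (q t))\<^sup>2 / 2"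
        using sum_squares_bound[of "norm (p t)" "norm (q t)"] by simp
      also have "(norm (p t))\<^sup>2 \<le> K\<^sup>2 * (norm (z t))\<^sup>2"
        using power_mono[OF p_le[OF that], of 2] by (simp add: power_mult_distrib)
      finally show ?thesis by simp
    qed
    ultimately have "(norm (A (z t)))\<^sup>2 - p t \<bullet> q t - (norm (q t))\<^sup>2
        \<le> P * (norm (z t))\<^sup>2 - \<beta> / 2 * (norm (m t))\<^sup>2"
      using below[of "m t"] unfolding P_def q_def by (simp add: algebra_simps)
    then have "V' t \<le> - \<alpha> * (norm (z t))\<^sup>2 + \<epsilon> * (P * (norm (z t))\<^sup>2 - \<beta> / 2 * (norm (m t))\<^sup>2)"
      unfolding V'_def using mono[of t] mult_left_mono[OF _ less_imp_le[OF \<epsilon>(1)]] by fastforce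
    also have "\<dots> = - ((\<alpha> - \<epsilon> * P) * (norm (z t))\<^sup>2 + \<epsilon> * \<beta> / 2 * (norm (m t))\<^sup>2)"
      by (simp add: algebra_simps)
    also have "\<dots> \<le> - (c * (norm (z t))\<^sup>2 + c * (norm (m t))\<^sup>2)"
      using c \<epsilon>(3) by (intro le_imp_neg_le add_mono mult_right_mono) auto
    also have "\<dots> = - c * (2 * E t)"
      by (simp add: E_norm algebra_simps)
    also have "\<dots> \<le> - c * V t"
      using cross[of t] c(1) E_norm[of t] by (simp add: V_def abs_le_iff)
    finally show ?thesis .
  qed
  \<comment> \<open>The left side is \<open>2 * E t\<close>, and the bound on the cross term gives
    \<open>E t \<le> 2 * V t\<close>; hence the factor 4.\<close>
  have "(norm (z t))\<^sup>2 + (norm (m t))\<^sup>2 \<le> (4 * V 0) * exp (- c * t)" if "t \<ge> 0" for t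
  proof -
    have "(norm (z t))\<^sup>2 + (norm (m t))\<^sup>2 \<le> 4 * V t"
      using abs_le_D2[OF cross[of t]] unfolding V_def E_norm by argo
    also have "\<dots> \<le> 4 * (V 0 * exp (- c * t))"
      using exp_decay_of_differential_ineq[OF dV V'_le that] by simp
    finally show ?thesis by simp
  qed
  then show ?thesis
    using that[OF c(1) \<open>K \<ge> 0\<close>] p_le unfolding z_def m_def p_def by blast
qed

section \<open>From exponential decay to the stated rates\<close>

theorem proposition3p5:
  fixes f :: "'a::{real_inner, complete_space} \<Rightarrow> real"
    and gradf :: "'a \<Rightarrow> 'a"
    and A :: "'a \<Rightarrow> 'b::{real_inner, complete_space}"
    and b :: 'b
    and \<alpha> \<beta> :: real
    and x0 :: 'a and lam0 :: 'b
    and x :: "real \<Rightarrow> 'a" and lam :: "real \<Rightarrow> 'b"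
  assumes "convex_on UNIV f"
    and "\<And>z. GDERIV f z :> gradf z"
    and "continuous_on UNIV gradf"
    and "lipschitz_on_bounded_sets gradf"
    and "bounded_linear A"
    and "\<alpha> > 0" and "strongly_monotone \<alpha> gradf"
    and "\<beta> > 0" and "\<And>y. (norm (adjoint A y))\<^sup>2 \<ge> \<beta> * (norm y)\<^sup>2"
    and "AH_solution gradf A b x0 lam0 x lam"
  shows "\<exists>\<xi> \<eta>. saddle_points (lagrangian f A b) = {(\<xi>, \<eta>)} \<and>
    (\<lambda>t. lagrangian f A b (x t) \<eta> - lagrangian f A b \<xi> (lam t)) \<in> o[at_top](\<lambda>t. 1 / t) \<and>
    (\<lambda>t. norm ((x t, lam t) - (\<xi>, \<eta>))) \<in> o[at_top](\<lambda>t. 1 / sqrt t) \<and>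
    ((\<lambda>t. (x t, lam t)) \<longlongrightarrow> (\<xi>, \<eta>)) at_top"
proof -
  note f = assms(2) and A = assms(5) and \<alpha> = assms(6) and g = assms(7)
  obtain \<xi> \<eta> where KKT: "A \<xi> = b" "gradf \<xi> + adjoint A \<eta> = 0"
    using exists_KKT_point[OF f \<alpha> g A assms(8,9)] .
  have saddle: "saddle_points (lagrangian f A b) = {(\<xi>, \<eta>)}"
  proof -
    have "p \<in> saddle_points (lagrangian f A b) \<longleftrightarrow> p = (\<xi>, \<eta>)" for p
    proof (cases p)
      case (Pair u y)
      show ?thesis
        unfolding Pair saddle_point_iff_KKT[OF f less_imp_le[OF \<alpha>] g A]
        using KKT_point_unique[OF \<alpha> g A assms(8,9) _ _ KKT, of u y] KKT by blast
    qed
    then show ?thesis by blast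
  qed
  obtain c K C where c: "c > 0" "K \<ge> 0"
    and decay: "\<And>t. t \<ge> 0 \<Longrightarrow> (norm (x t - \<xi>))\<^sup>2 + (norm (lam t - \<eta>))\<^sup>2 \<le> C * exp (- c * t)"
    and lip: "\<And>t. t \<ge> 0 \<Longrightarrow> norm (gradf (x t) - gradf \<xi>) \<le> K * norm (x t - \<xi>)"
    by (rule AH_exp_decay[OF assms(4) \<alpha> g A assms(8,9,10) KKT]) blast
  let ?gap = "\<lambda>t. lagrangian f A b (x t) \<eta> - lagrangian f A b \<xi> (lam t)"
  let ?dist = "\<lambda>t. norm ((x t, lam t) - (\<xi>, \<eta>))"
  have dist_le: "?dist t \<le> sqrt C * exp (- c / 2 * t)" if "t \<ge> 0" for t
  proof -
    have "?dist t \<le> sqrt (C * exp (- c * t))"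
      using decay[OF that] by (simp add: norm_Pair)
    also have "exp (- c * t) = (exp (- c / 2 * t))\<^sup>2"
      by (simp flip: exp_double)
    finally show ?thesis by (simp add: real_sqrt_mult)
  qed
  have gap_le: "\<bar>?gap t\<bar> \<le> K * C * exp (- c * t)" if "t \<ge> 0" for t
  proof -
    \<comment> \<open>The gap is the Bregman distance of \<open>f\<close> from \<xi> to
      \<open>x t\<close>. The gradient inequality based at \<xi> makes it nonnegative; the one based
      at \<open>x t\<close> bounds it by the gradient difference paired with
      \<open>x t - \<xi>\<close>, which is quadratic in the distance.\<close>
    have gap: "?gap t = f (x t) - f \<xi> - gradf \<xi> \<bullet> (x t - \<xi>)"
    proof -
      have "\<eta> \<bullet> (A (x t) - b) = (x t - \<xi>) \<bullet> adjoint A \<eta>"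
        using KKT by (simp add: inner_commute[of \<eta>] linear_diff[OF bounded_linear.linear[OF A]]
            flip: adjoint_inner_Hilbert[OF A])
      moreover have "adjoint A \<eta> = - gradf \<xi>"
        using KKT(2) by (simp add: eq_neg_iff_add_eq_0 add.commute)
      ultimately show ?thesis
        using KKT by (simp add: lagrangian_def inner_commute)
    qed
    have sq: "0 \<le> \<alpha> / 2 * (norm (x t - \<xi>))\<^sup>2" "0 \<le> \<alpha> / 2 * (norm (\<xi> - x t))\<^sup>2"
      using \<alpha> by auto
    have "0 \<le> ?gap t"
      unfolding gap using strongly_monotone_gradient_ineq[OF f g, of \<xi> "x t"] sq by linarith
    moreover have "?gap t \<le> (gradf (x t) - gradf \<xi>) \<bullet> (x t - \<xi>)"
      unfolding gap using strongly_monotone_gradient_ineq[OF f g, of "x t" \<xi>] sq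
      by (simp add: inner_diff_left inner_diff_right)
    moreover have "\<dots> \<le> norm (gradf (x t) - gradf \<xi>) * norm (x t - \<xi>)"
      by (rule norm_cauchy_schwarz)
    moreover have "\<dots> \<le> K * norm (x t - \<xi>) * norm (x t - \<xi>)"
      using lip[OF that] by (rule mult_right_mono) simp
    moreover have "\<dots> \<le> K * (C * exp (- c * t))"
    proof -
      have "(norm (x t - \<xi>))\<^sup>2 \<le> C * exp (- c * t)"
        using decay[OF that] zero_le_power2[of "norm (lam t - \<eta>)"] by argo
      from mult_left_mono[OF this c(2)] show ?thesis
        by (simp add: mult.assoc power2_eq_square)
    qed
    ultimately show ?thesis by simp
  qed
  have "?gap \<in> O[at_top](\<lambda>t. exp (- c * t))"
    by (rule bigoI[of _ "K * C"])
      (use gap_le in \<open>auto intro!: eventually_mono[OF eventually_ge_at_top[of 0]]\<close>)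
  also have "(\<lambda>t. exp (- c * t)) \<in> o[at_top](\<lambda>t. 1 / t)"
    using c(1) by real_asymp
  finally have gap_o: "?gap \<in> o[at_top](\<lambda>t. 1 / t)" .
  have "?dist \<in> O[at_top](\<lambda>t. exp (- c / 2 * t))"
    by (rule bigoI[of _ "sqrt C"])
      (use dist_le in \<open>auto intro!: eventually_mono[OF eventually_ge_at_top[of 0]]\<close>)
  also have "(\<lambda>t. exp (- c / 2 * t)) \<in> o[at_top](\<lambda>t. 1 / sqrt t)"
    using c(1) by real_asymp
  finally have dist_o: "?dist \<in> o[at_top](\<lambda>t. 1 / sqrt t)" .
  also have "(\<lambda>t. 1 / sqrt t) \<in> O[at_top](\<lambda>_. 1)"
    by real_asymp
  finally have "?dist \<in> o[at_top](\<lambda>_. 1)" .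
  then have "(?dist \<longlongrightarrow> 0) at_top"
    by (auto dest: smalloD_tendsto)
  then have "((\<lambda>t. (x t, lam t)) \<longlongrightarrow> (\<xi>, \<eta>)) at_top"
    unfolding tendsto_norm_zero_iff by (rule LIM_zero_cancel)
  then show ?thesis
    using saddle gap_o dist_o by blast
qed

end
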